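(* For every positive integer $\ell$, the maximal number of Hamiltonian paths of the complete graph $K_n$ such that the union of every two distinct ones contains a cycle $C_{2^\ell+1}$ of length $2^\ell+1$ is $2^{n-o(n)}$ as $n\to\infty$ (with $\ell$ fixed).
   Context: $K_n$ is the complete graph on the labelled vertex set $[n]=\{1,\ldots,n\}$; Hamiltonian paths are undirected spanning paths, viewed as subgraphs of $K_n$. The union of two graphs on the same vertex set is the graph on that vertex set whose edge set is the union of the two edge sets. "Contains" means as a (not necessarily induced) subgraph. *)

theory Defs
  imports Complex_Main "HOL-Library.Landau_Symbols"
begin

text \<open>A simple graph is a pair of a vertex set and a set of two-element sets of vertices. All
  graphs below are subgraphs of a complete graph, so no well-formedness predicate is needed.\<close>

type_synonym 'a ugraph = "'a set \<times> 'a set set"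

definition graph_union :: "'a ugraph \<Rightarrow> 'a ugraph \<Rightarrow> 'a ugraph" where
  "graph_union G H = (fst G \<union> fst H, snd G \<union> snd H)"

definition subgraph :: "'a ugraph \<Rightarrow> 'a ugraph \<Rightarrow> bool" where
  "subgraph H G \<longleftrightarrow> fst H \<subseteq> fst G \<and> snd H \<subseteq> snd G"

definition complete_graph :: "nat \<Rightarrow> nat ugraph" where
  "complete_graph n = ({1..n}, {e. e \<subseteq> {1..n} \<and> card e = 2})"

definition path_graph :: "'a list \<Rightarrow> 'a ugraph" where
  "path_graph xs = (set xs, {{xs ! i, xs ! Suc i} | i. Suc i < length xs})"

definition cycle_graph :: "'a list \<Rightarrow> 'a ugraph" where
  "cycle_graph xs = (set xs, {{xs ! i, xs ! (Suc i mod length xs)} | i. i < length xs})"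

text \<open>A Hamiltonian path is a subgraph, not a vertex sequence: a list and its reversal give the
  same element of this set.\<close>

definition hamiltonian_paths :: "'a ugraph \<Rightarrow> 'a ugraph set" where
  "hamiltonian_paths G =
     {path_graph xs | xs. distinct xs \<and> set xs = fst G \<and> subgraph (path_graph xs) G}"

definition contains_cycle :: "nat \<Rightarrow> 'a ugraph \<Rightarrow> bool" where
  "contains_cycle k G \<longleftrightarrow>
     k \<ge> 3 \<and> (\<exists>xs. distinct xs \<and> length xs = k \<and> subgraph (cycle_graph xs) G)"

definition cycle_union_families :: "nat \<Rightarrow> nat \<Rightarrow> nat ugraph set set" where
  "cycle_union_families k n =
     {F. F \<subseteq> hamiltonian_paths (complete_graph n) \<and>
         (\<forall>P\<in>F. \<forall>Q\<in>F. P \<noteq> Q \<longrightarrow> contains_cycle k (graph_union P Q))}"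

definition max_cycle_union_family :: "nat \<Rightarrow> nat \<Rightarrow> nat" where
  "max_cycle_union_family k n = Max (card ` cycle_union_families k n)"

text \<open>The families and their sizes are finite in number, so the maximum above is a genuine one.\<close>

lemma finite_hamiltonian_paths: "finite (hamiltonian_paths (complete_graph n))"
proof -
  have "hamiltonian_paths (complete_graph n)
      \<subseteq> path_graph ` {xs. set xs \<subseteq> {1..n} \<and> distinct xs}"
    by (auto simp: hamiltonian_paths_def complete_graph_def)
  then show ?thesis
    by (rule finite_subset) (intro finite_imageI finite_subset_distinct, simp)
qed

lemma finite_cycle_union_families: "finite (cycle_union_families k n)"
  by (rule finite_subset[of _ "Pow (hamiltonian_paths (complete_graph n))"])
    (auto simp: cycle_union_families_def finite_hamiltonian_paths)

lemma cycle_union_families_nonempty: "cycle_union_families k n \<noteq> {}"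
  by (auto simp: cycle_union_families_def)

end

theory Submission
  imports Defs "HOL-Library.Multiset"
begin

text \<open>Put \<open>d = 2 ^ l\<close>. For the upper bound, the vertices in even positions of a path form one class
  of a bipartition. If two paths give the same class, their union is bipartite and has no cycle of the
  odd length \<open>d + 1\<close>, so a family has at most \<open>2 ^ n\<close> members (\<open>max_cycle_union_family_le\<close>).

  For the lower bound, two paths have a cycle of length \<open>d + 1\<close> in their union as soon as some two
  vertices are neighbours in one path and at distance \<open>d\<close> in the other. Such paths are built from
  grids. A grid of width \<open>d\<close> is read row by row, so vertical neighbours end up at distance \<open>d\<close> and
  horizontal neighbours end up adjacent. Start with all vertices as grids of size 1 by 1 and repeatedly
  merge two grids \<open>X\<close>, \<open>Y\<close> of the same shape, spending one bit on the choice between putting \<open>X\<close> on top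
  of \<open>Y\<close>, and putting \<open>X\<close> with its rows in reverse order to the left of \<open>Y\<close> with every row
  reversed. The last entry of the last row of \<open>X\<close> and the last entry of the first row of \<open>Y\<close> are
  vertical neighbours after the first choice and horizontal neighbours after the second, and both kinds of
  neighbourhood survive all later merges. Hence paths arising from different choices are separated
  (\<open>separated_stack_fold_beside\<close>). A grid that has reached the full width \<open>d\<close> still carries one bit: each of
  its rows may be reversed. This moves its first entry from distance 1 to distance \<open>d\<close> of the vertex
  in front of the grid (\<open>separated_row_reversal\<close>). This step needs a width that is both a power of
  two, to be reached by doubling, and equal to \<open>d\<close>, which is where the cycle length \<open>2 ^ l + 1\<close>
  comes from.

  Every merge and every full-width grid contributes one bit, and these add up to one bit per
  vertex except for the grids that never reach full width. To control those, exactly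
  half of the pairs are stacked at every stage, which costs only a logarithmic number of bits. Thus
  \<open>4 ^ (t + 1)\<close> grids of one shape become \<open>4 ^ t\<close> stacked and \<open>4 ^ t\<close> widened ones, and both lots are
  merged further in the same way. A narrow grid that is left alone in its lot is padded to full width by
  extra vertices. Both the lost bits and the extra vertices are of order \<open>3 ^ t\<close> (\<open>merging_family\<close>), which is
  negligible against \<open>4 ^ t\<close>. Independent blocks of this kind, one after the other, cover every large
  \<open>n\<close> up to a bounded remainder (\<open>max_cycle_union_family_ge\<close>).\<close>

section \<open>Pairs at a fixed distance in a word\<close>

definition gap_pairs :: "nat \<Rightarrow> 'a list \<Rightarrow> 'a set set" where
  "gap_pairs d xs = {{xs ! i, xs ! (i + d)} | i. i + d < length xs}"

lemma gap_pairsI: "i + d < length xs \<Longrightarrow> a = xs ! i \<Longrightarrow> b = xs ! (i + d) \<Longrightarrow> {a, b} \<in> gap_pairs d xs"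
  by (auto simp: gap_pairs_def)

lemma gap_pairs_append1: "gap_pairs d xs \<subseteq> gap_pairs d (xs @ ys)"
proof
  fix e assume "e \<in> gap_pairs d xs"
  then obtain i where "e = {xs ! i, xs ! (i + d)}" "i + d < length xs"
    by (auto simp: gap_pairs_def)
  then show "e \<in> gap_pairs d (xs @ ys)"
    by (auto simp: nth_append intro!: gap_pairsI[of i])
qed

lemma gap_pairs_append2: "gap_pairs d ys \<subseteq> gap_pairs d (xs @ ys)"
proof
  fix e assume "e \<in> gap_pairs d ys"
  then obtain i where "e = {ys ! i, ys ! (i + d)}" "i + d < length ys"
    by (auto simp: gap_pairs_def)
  then show "e \<in> gap_pairs d (xs @ ys)"
    by (auto simp: nth_append intro!: gap_pairsI[of "length xs + i"])
qed

lemma gap_pairs_disjoint: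
  assumes "distinct xs" "d \<noteq> d'"
  shows "gap_pairs d xs \<inter> gap_pairs d' xs = {}"
proof (rule ccontr)
  assume "gap_pairs d xs \<inter> gap_pairs d' xs \<noteq> {}"
  then obtain i j where *: "i + d < length xs" "j + d' < length xs"
      "{xs ! i, xs ! (i + d)} = {xs ! j, xs ! (j + d')}"
    by (auto simp: gap_pairs_def)
  then have "i = j \<and> i + d = j + d' \<or> i = j + d' \<and> i + d = j"
    using assms(1) by (auto simp: doubleton_eq_iff nth_eq_iff_index_eq)
  then show False using assms(2) by auto
qed

text \<open>For \<open>d \<ge> 2\<close>, this is the certificate for a cycle of length \<open>d + 1\<close> in the union of the two paths:
  \<open>d\<close> consecutive edges of one path, closed up by an edge of the other.\<close>

definition separated :: "nat \<Rightarrow> 'a list \<Rightarrow> 'a list \<Rightarrow> bool" where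
  "separated d xs ys \<longleftrightarrow>
     gap_pairs 1 xs \<inter> gap_pairs d ys \<noteq> {} \<or> gap_pairs d xs \<inter> gap_pairs 1 ys \<noteq> {}"

lemma separated_sym: "separated d xs ys \<longleftrightarrow> separated d ys xs"
  by (auto simp: separated_def)

lemma separated_append:
  assumes "separated d xs ys"
  shows "separated d (us @ xs @ vs) (us @ ys @ vs')"
proof -
  have "gap_pairs k zs \<subseteq> gap_pairs k (us @ zs @ ws)" for k and zs ws :: "'a list"
    by (meson gap_pairs_append1 gap_pairs_append2 subset_trans)
  then show ?thesis using assms unfolding separated_def by blast
qed

text \<open>Two separated words do not merely differ; they even define different paths, since in a word
  without repetition a pair occurs at one distance only. This makes all the counting below injective.\<close>

lemma separated_imp_adjacencies_differ:
  assumes "separated d xs ys" "distinct xs" "distinct ys" "d \<ge> 2"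
  shows "gap_pairs 1 xs \<noteq> gap_pairs 1 ys"
  using assms gap_pairs_disjoint[of xs 1 d] gap_pairs_disjoint[of ys 1 d]
  by (auto simp: separated_def)

section \<open>Families of pairwise separated words\<close>

text \<open>The nonempty prefix \<open>ws\<close> stands for the part of the path that precedes the block under
  construction; it is needed because the orientation of a full-width grid shows only relative to the vertex
  in front of it.\<close>

definition separated_family :: "nat \<Rightarrow> 'a multiset \<Rightarrow> 'a list set \<Rightarrow> bool" where
  "separated_family d M F \<longleftrightarrow>
     (\<forall>xs\<in>F. mset xs = M) \<and>
     (\<forall>xs\<in>F. \<forall>ys\<in>F. xs \<noteq> ys \<longrightarrow> (\<forall>ws. ws \<noteq> [] \<longrightarrow> separated d (ws @ xs) (ws @ ys)))"

lemma separated_family_finite: "separated_family d M F \<Longrightarrow> finite F"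
  by (rule finite_subset[of _ "{xs. set xs \<subseteq> set_mset M \<and> length xs = size M}"])
    (auto simp: separated_family_def intro!: finite_lists_length_eq)

lemma separated_family_singleton: "separated_family d (mset xs) {xs}"
  by (auto simp: separated_family_def)

definition juxtapose :: "'a list set \<Rightarrow> 'a list set \<Rightarrow> 'a list set" where
  "juxtapose F G = (\<lambda>(xs, ys). xs @ ys) ` (F \<times> G)"

lemma in_juxtapose_iff: "zs \<in> juxtapose F G \<longleftrightarrow> (\<exists>xs\<in>F. \<exists>ys\<in>G. zs = xs @ ys)"
  by (auto simp: juxtapose_def)

text \<open>If the first parts agree, they extend the common prefix of the second parts. This is why
  separation is required behind every nonempty prefix.\<close>

lemma separated_family_juxtapose:
  assumes F: "separated_family d M F" and G: "separated_family d N G"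
  shows "separated_family d (M + N) (juxtapose F G)"
    and "card (juxtapose F G) = card F * card G"
proof -
  have len: "length xs = size M" if "xs \<in> F" for xs
    using F that by (metis separated_family_def size_mset)
  have sep: "separated d (ws @ xs @ ys) (ws @ xs' @ ys')"
    if "xs \<in> F" "xs' \<in> F" "ys \<in> G" "ys' \<in> G" "xs @ ys \<noteq> xs' @ ys'" "ws \<noteq> []"
    for xs xs' ys ys' ws
  proof (cases "xs = xs'")
    case True
    then have "separated d ((ws @ xs) @ ys) ((ws @ xs) @ ys')"
      using G that unfolding separated_family_def by blast
    then show ?thesis using True by simp
  next
    case False
    then have "separated d (ws @ xs) (ws @ xs')"
      using F that unfolding separated_family_def by blast
    from separated_append[OF this, of "[]" ys ys'] show ?thesis by simp
  qed
  show "separated_family d (M + N) (juxtapose F G)"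
    using F G sep by (auto simp: separated_family_def juxtapose_def)
  have "inj_on (\<lambda>(xs, ys). xs @ ys) (F \<times> G)"
    using len by (auto simp: inj_on_def)
  then show "card (juxtapose F G) = card F * card G"
    unfolding juxtapose_def by (simp add: card_image card_cartesian_product)
qed

definition simple_mset :: "'a multiset \<Rightarrow> bool" where
  "simple_mset M \<longleftrightarrow> (\<forall>a. count M a \<le> 1)"

lemma simple_mset_addD: "simple_mset (M + N) \<Longrightarrow> simple_mset M \<and> simple_mset N"
  unfolding simple_mset_def count_union by (meson add_leD1 add_leD2)

lemma distinct_if_simple_mset: "simple_mset (mset xs) \<Longrightarrow> distinct xs"
proof (induction xs)
  case (Cons a xs)
  have "count (mset (a # xs)) a \<le> 1" using Cons.prems unfolding simple_mset_def by blast
  then have "a \<notin> set xs" by (simp flip: count_eq_zero_iff)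
  moreover have "simple_mset (mset xs)"
    using Cons.prems simple_mset_addD[of "{#a#}" "mset xs"] by simp
  ultimately show ?case using Cons.IH by simp
qed simp

text \<open>Different choices of merges are told apart inside the words themselves, so across different
  indices no prefix is involved; in particular the families \<open>G T\<close> are disjoint and their sizes add up.\<close>

lemma separated_family_UN:
  assumes "finite \<T>" "d \<ge> 2" "simple_mset M"
    and fam: "\<And>T. T \<in> \<T> \<Longrightarrow> separated_family d M (G T)"
    and sep: "\<And>T T' xs ys. T \<in> \<T> \<Longrightarrow> T' \<in> \<T> \<Longrightarrow> T \<noteq> T' \<Longrightarrow> xs \<in> G T \<Longrightarrow> ys \<in> G T'
      \<Longrightarrow> separated d xs ys"
  shows "separated_family d M (\<Union>T\<in>\<T>. G T)"
    and "card (\<Union>T\<in>\<T>. G T) = (\<Sum>T\<in>\<T>. card (G T))"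
proof -
  let ?F = "\<Union>T\<in>\<T>. G T"
  have "separated d (ws @ xs) (ws @ ys)"
    if asm: "xs \<in> ?F" "ys \<in> ?F" "xs \<noteq> ys" "ws \<noteq> []" for xs ys ws
  proof -
    obtain T T' where T: "T \<in> \<T>" "xs \<in> G T" "T' \<in> \<T>" "ys \<in> G T'" using asm by blast
    show ?thesis
    proof (cases "T = T'")
      case True
      then show ?thesis using fam T asm unfolding separated_family_def by blast
    next
      case False
      then show ?thesis
        using separated_append[OF sep[OF T(1,3) _ T(2,4)], of ws "[]" "[]"] by simp
    qed
  qed
  then show "separated_family d M ?F"
    using fam unfolding separated_family_def by blast
  have "G T \<inter> G T' = {}" if T: "T \<in> \<T>" "T' \<in> \<T>" "T \<noteq> T'" for T T'
  proof (rule ccontr)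
    assume "G T \<inter> G T' \<noteq> {}"
    then obtain xs where xs: "xs \<in> G T" "xs \<in> G T'" by blast
    then have "mset xs = M" using fam[OF T(1)] by (simp add: separated_family_def)
    then have "distinct xs" using distinct_if_simple_mset \<open>simple_mset M\<close> by metis
    then show False
      using separated_imp_adjacencies_differ[OF sep[OF T xs]] \<open>d \<ge> 2\<close> by blast
  qed
  then show "card ?F = (\<Sum>T\<in>\<T>. card (G T))"
    using fam separated_family_finite by (intro card_UN_disjoint[OF \<open>finite \<T>\<close>]) blast+
qed

section \<open>Grids and the two ways of merging them\<close>

definition grid :: "nat \<Rightarrow> nat \<Rightarrow> 'a list list \<Rightarrow> bool" where
  "grid R c X \<longleftrightarrow> length X = R \<and> (\<forall>i<R. length (X ! i) = c)"

definition vertical_pairs :: "'a list list \<Rightarrow> 'a set set" where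
  "vertical_pairs X =
     {{X ! i ! k, X ! Suc i ! k} | i k. Suc i < length X \<and> k < length (X ! i)}"

definition horizontal_pairs :: "'a list list \<Rightarrow> 'a set set" where
  "horizontal_pairs X =
     {{X ! i ! k, X ! i ! Suc k} | i k. i < length X \<and> Suc k < length (X ! i)}"

lemma vertical_pairsI:
  "Suc i < length X \<Longrightarrow> k < length (X ! i) \<Longrightarrow> {a, b} = {X ! i ! k, X ! Suc i ! k}
    \<Longrightarrow> {a, b} \<in> vertical_pairs X"
  by (auto simp: vertical_pairs_def)

lemma horizontal_pairsI:
  "i < length X \<Longrightarrow> Suc k < length (X ! i) \<Longrightarrow> {a, b} = {X ! i ! k, X ! i ! Suc k}
    \<Longrightarrow> {a, b} \<in> horizontal_pairs X"
  by (auto simp: horizontal_pairs_def)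

definition stack :: "'a list list \<Rightarrow> 'a list list \<Rightarrow> 'a list list" where
  "stack X Y = X @ Y"

definition beside :: "'a list list \<Rightarrow> 'a list list \<Rightarrow> 'a list list" where
  "beside X Y = map2 (@) X Y"

lemma grid_stack: "grid R c X \<Longrightarrow> grid S c Y \<Longrightarrow> grid (R + S) c (stack X Y)"
  by (auto simp: grid_def stack_def nth_append)

lemma grid_beside: "grid R c X \<Longrightarrow> grid R c' Y \<Longrightarrow> grid R (c + c') (beside X Y)"
  by (auto simp: grid_def beside_def)

lemma grid_rev: "grid R c X \<Longrightarrow> grid R c (rev X)"
  by (auto simp: grid_def rev_nth)

lemma grid_map_rev: "grid R c X \<Longrightarrow> grid R c (map rev X)"
  by (auto simp: grid_def)

lemma mset_concat_stack: "mset (concat (stack X Y)) = mset (concat X) + mset (concat Y)"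
  by (simp add: stack_def)

lemma mset_concat_beside:
  "length X = length Y \<Longrightarrow> mset (concat (beside X Y)) = mset (concat X) + mset (concat Y)"
  unfolding beside_def by (induction X Y rule: list_induct2) auto

lemma mset_concat_rev: "mset (concat (rev X)) = mset (concat X)"
  by (induction X) auto

lemma mset_concat_map_rev: "mset (concat (map rev X)) = mset (concat X)"
  by (induction X) auto

lemma pairs_stack:
  "vertical_pairs X \<subseteq> vertical_pairs (stack X Y)"
  "vertical_pairs Y \<subseteq> vertical_pairs (stack X Y)"
  "horizontal_pairs X \<subseteq> horizontal_pairs (stack X Y)"
  "horizontal_pairs Y \<subseteq> horizontal_pairs (stack X Y)"
proof -
  show "vertical_pairs X \<subseteq> vertical_pairs (stack X Y)"
  proof
    fix e assume "e \<in> vertical_pairs X"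
    then obtain i k where "e = {X ! i ! k, X ! Suc i ! k}" "Suc i < length X" "k < length (X ! i)"
      by (auto simp: vertical_pairs_def)
    then show "e \<in> vertical_pairs (stack X Y)"
      by (auto simp: stack_def nth_append intro!: vertical_pairsI[of i _ k])
  qed
  show "vertical_pairs Y \<subseteq> vertical_pairs (stack X Y)"
  proof
    fix e assume "e \<in> vertical_pairs Y"
    then obtain i k where "e = {Y ! i ! k, Y ! Suc i ! k}" "Suc i < length Y" "k < length (Y ! i)"
      by (auto simp: vertical_pairs_def)
    then show "e \<in> vertical_pairs (stack X Y)"
      by (auto simp: stack_def nth_append intro!: vertical_pairsI[of "length X + i" _ k])
  qed
  show "horizontal_pairs X \<subseteq> horizontal_pairs (stack X Y)"
  proof
    fix e assume "e \<in> horizontal_pairs X"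
    then obtain i k where "e = {X ! i ! k, X ! i ! Suc k}" "i < length X" "Suc k < length (X ! i)"
      by (auto simp: horizontal_pairs_def)
    then show "e \<in> horizontal_pairs (stack X Y)"
      by (auto simp: stack_def nth_append intro!: horizontal_pairsI[of i _ k])
  qed
  show "horizontal_pairs Y \<subseteq> horizontal_pairs (stack X Y)"
  proof
    fix e assume "e \<in> horizontal_pairs Y"
    then obtain i k where "e = {Y ! i ! k, Y ! i ! Suc k}" "i < length Y" "Suc k < length (Y ! i)"
      by (auto simp: horizontal_pairs_def)
    then show "e \<in> horizontal_pairs (stack X Y)"
      by (auto simp: stack_def nth_append intro!: horizontal_pairsI[of "length X + i" _ k])
  qed
qed

lemma pairs_beside:
  assumes "grid R c X" "grid R c' Y"
  shows "vertical_pairs X \<subseteq> vertical_pairs (beside X Y)"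
    and "vertical_pairs Y \<subseteq> vertical_pairs (beside X Y)"
    and "horizontal_pairs X \<subseteq> horizontal_pairs (beside X Y)"
    and "horizontal_pairs Y \<subseteq> horizontal_pairs (beside X Y)"
proof -
  note g = assms[unfolded grid_def]
  show "vertical_pairs X \<subseteq> vertical_pairs (beside X Y)"
  proof
    fix e assume "e \<in> vertical_pairs X"
    then obtain i k where "e = {X ! i ! k, X ! Suc i ! k}" "Suc i < R" "k < c"
      using g by (auto simp: vertical_pairs_def)
    then show "e \<in> vertical_pairs (beside X Y)"
      using g by (auto simp: beside_def nth_append intro!: vertical_pairsI[of i _ k])
  qed
  show "vertical_pairs Y \<subseteq> vertical_pairs (beside X Y)"
  proof
    fix e assume "e \<in> vertical_pairs Y"
    then obtain i k where "e = {Y ! i ! k, Y ! Suc i ! k}" "Suc i < R" "k < c'"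
      using g by (auto simp: vertical_pairs_def)
    then show "e \<in> vertical_pairs (beside X Y)"
      using g by (auto simp: beside_def nth_append intro!: vertical_pairsI[of i _ "c + k"])
  qed
  show "horizontal_pairs X \<subseteq> horizontal_pairs (beside X Y)"
  proof
    fix e assume "e \<in> horizontal_pairs X"
    then obtain i k where "e = {X ! i ! k, X ! i ! Suc k}" "i < R" "Suc k < c"
      using g by (auto simp: horizontal_pairs_def)
    then show "e \<in> horizontal_pairs (beside X Y)"
      using g by (auto simp: beside_def nth_append intro!: horizontal_pairsI[of i _ k])
  qed
  show "horizontal_pairs Y \<subseteq> horizontal_pairs (beside X Y)"
  proof
    fix e assume "e \<in> horizontal_pairs Y"
    then obtain i k where "e = {Y ! i ! k, Y ! i ! Suc k}" "i < R" "Suc k < c'"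
      using g by (auto simp: horizontal_pairs_def)
    then show "e \<in> horizontal_pairs (beside X Y)"
      using g by (auto simp: beside_def nth_append intro!: horizontal_pairsI[of i _ "c + k"])
  qed
qed

lemma pairs_rev:
  assumes "grid R c X"
  shows "vertical_pairs X \<subseteq> vertical_pairs (rev X)"
    and "horizontal_pairs X \<subseteq> horizontal_pairs (rev X)"
proof -
  note g = assms[unfolded grid_def]
  show "vertical_pairs X \<subseteq> vertical_pairs (rev X)"
  proof
    fix e assume "e \<in> vertical_pairs X"
    then obtain i k where "e = {X ! i ! k, X ! Suc i ! k}" "Suc i < R" "k < c"
      using g by (auto simp: vertical_pairs_def)
    then show "e \<in> vertical_pairs (rev X)"
      using g by (auto simp: rev_nth Suc_diff_Suc intro!: vertical_pairsI[of "R - Suc (Suc i)" _ k])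
  qed
  show "horizontal_pairs X \<subseteq> horizontal_pairs (rev X)"
  proof
    fix e assume "e \<in> horizontal_pairs X"
    then obtain i k where "e = {X ! i ! k, X ! i ! Suc k}" "i < R" "Suc k < c"
      using g by (auto simp: horizontal_pairs_def)
    then show "e \<in> horizontal_pairs (rev X)"
      using g by (auto simp: rev_nth intro!: horizontal_pairsI[of "R - Suc i" _ k])
  qed
qed

lemma pairs_map_rev:
  assumes "grid R c X"
  shows "vertical_pairs X \<subseteq> vertical_pairs (map rev X)"
    and "horizontal_pairs X \<subseteq> horizontal_pairs (map rev X)"
proof -
  note g = assms[unfolded grid_def]
  show "vertical_pairs X \<subseteq> vertical_pairs (map rev X)"
  proof
    fix e assume "e \<in> vertical_pairs X"
    then obtain i k where "e = {X ! i ! k, X ! Suc i ! k}" "Suc i < R" "k < c"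
      using g by (auto simp: vertical_pairs_def)
    then show "e \<in> vertical_pairs (map rev X)"
      using g by (auto simp: rev_nth intro!: vertical_pairsI[of i _ "c - Suc k"])
  qed
  show "horizontal_pairs X \<subseteq> horizontal_pairs (map rev X)"
  proof
    fix e assume "e \<in> horizontal_pairs X"
    then obtain i k where "e = {X ! i ! k, X ! i ! Suc k}" "i < R" "Suc k < c"
      using g by (auto simp: horizontal_pairs_def)
    then show "e \<in> horizontal_pairs (map rev X)"
      using g by (auto simp: rev_nth Suc_diff_Suc intro!: horizontal_pairsI[of i _ "c - Suc (Suc k)"])
  qed
qed

lemma length_concat_grid: "grid R c X \<Longrightarrow> length (concat X) = R * c"
proof (induction X arbitrary: R)
  case (Cons r X)
  then obtain R' where R: "R = Suc R'" by (auto simp: grid_def)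
  have "grid R' c X" "length r = c" using Cons.prems R by (auto simp: grid_def)
  then show ?case using Cons.IH R by simp
qed (simp add: grid_def)

lemma nth_concat_grid:
  "grid R c X \<Longrightarrow> i < R \<Longrightarrow> k < c \<Longrightarrow> concat X ! (i * c + k) = X ! i ! k"
proof (induction X arbitrary: R i)
  case (Cons r X)
  then obtain R' where R: "R = Suc R'" by (auto simp: grid_def)
  have "grid R' c X" "length r = c" using Cons.prems R by (auto simp: grid_def)
  then show ?case using Cons.IH[of R'] Cons.prems R
    by (cases i) (auto simp: nth_append add.assoc)
qed (simp add: grid_def)

lemma grid_index_less:
  fixes i R k c :: nat
  assumes "i < R" "k < c"
  shows "i * c + k < R * c"
proof -
  have "Suc i * c \<le> R * c" using assms(1) by (intro mult_le_mono1) simp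
  then show ?thesis using assms(2) by simp
qed

text \<open>The last entry of a row and the first entry of the next row also become adjacent, hence only
  inclusions.\<close>

lemma gap_pairs_concat_grid:
  assumes "grid R d X"
  shows "vertical_pairs X \<subseteq> gap_pairs d (concat X)"
    and "horizontal_pairs X \<subseteq> gap_pairs 1 (concat X)"
proof -
  note g = assms[unfolded grid_def]
  show "vertical_pairs X \<subseteq> gap_pairs d (concat X)"
  proof
    fix e assume "e \<in> vertical_pairs X"
    then obtain i k where *: "e = {X ! i ! k, X ! Suc i ! k}" "Suc i < R" "k < d"
      using g by (auto simp: vertical_pairs_def)
    show "e \<in> gap_pairs d (concat X)"
      unfolding *(1)
      using * nth_concat_grid[OF assms, of i k] nth_concat_grid[OF assms, of "Suc i" k]
        grid_index_less[of "Suc i" R k d]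
      by (intro gap_pairsI[of "i * d + k"])
        (auto simp: length_concat_grid[OF assms] algebra_simps)
  qed
  show "horizontal_pairs X \<subseteq> gap_pairs 1 (concat X)"
  proof
    fix e assume "e \<in> horizontal_pairs X"
    then obtain i k where *: "e = {X ! i ! k, X ! i ! Suc k}" "i < R" "Suc k < d"
      using g by (auto simp: horizontal_pairs_def)
    show "e \<in> gap_pairs 1 (concat X)"
      unfolding *(1)
      using * nth_concat_grid[OF assms, of i k] nth_concat_grid[OF assms, of i "Suc k"]
        grid_index_less[of i R "Suc k" d]
      by (intro gap_pairsI[of "i * d + k"])
        (auto simp: length_concat_grid[OF assms])
  qed
qed

section \<open>Reading full-width grids row by row\<close>

definition contains_grid :: "nat \<Rightarrow> 'a list \<Rightarrow> 'a list list \<Rightarrow> bool" where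
  "contains_grid d xs X \<longleftrightarrow>
     vertical_pairs X \<subseteq> gap_pairs d xs \<and> horizontal_pairs X \<subseteq> gap_pairs 1 xs"

lemma contains_grid_append:
  "contains_grid d xs X \<Longrightarrow> contains_grid d (us @ xs @ vs) X"
  unfolding contains_grid_def
  by (meson gap_pairs_append1 gap_pairs_append2 subset_trans)

lemma contains_grid_concat:
  "grid R d X \<Longrightarrow> contains_grid d (concat X) X"
  unfolding contains_grid_def by (blast dest: gap_pairs_concat_grid)

lemma contains_grid_concat_map_rev:
  "grid R d X \<Longrightarrow> contains_grid d (concat (map rev X)) X"
  unfolding contains_grid_def
  by (meson gap_pairs_concat_grid grid_map_rev pairs_map_rev subset_trans)

text \<open>The two reversals bring the last row of \<open>X\<close> next to the first row of \<open>Y\<close>, and there the last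
  entry of the one next to the last entry of the other. These two entries lie in the same column of the
  stack.\<close>

definition fold_beside :: "'a list list \<Rightarrow> 'a list list \<Rightarrow> 'a list list" where
  "fold_beside X Y = beside (rev X) (map rev Y)"

lemma grid_fold_beside: "grid R c X \<Longrightarrow> grid R c Y \<Longrightarrow> grid R (2 * c) (fold_beside X Y)"
  using grid_beside[OF grid_rev grid_map_rev, of R c X c Y]
  by (simp add: fold_beside_def mult_2)

lemma mset_concat_fold_beside:
  "grid R c X \<Longrightarrow> grid R c Y \<Longrightarrow>
    mset (concat (fold_beside X Y)) = mset (concat X) + mset (concat Y)"
  unfolding fold_beside_def
  by (subst mset_concat_beside) (auto simp: grid_def mset_concat_rev mset_concat_map_rev simp del: mset_concat)

lemma contains_grid_stackD:
  "contains_grid d xs (stack X Y) \<Longrightarrow> contains_grid d xs X \<and> contains_grid d xs Y"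
  using pairs_stack(1,3)[of X Y] pairs_stack(2,4)[of Y X]
  unfolding contains_grid_def by blast

lemma contains_grid_fold_besideD:
  assumes "grid R c X" "grid R c Y" "contains_grid d xs (fold_beside X Y)"
  shows "contains_grid d xs X \<and> contains_grid d xs Y"
  using assms(3) pairs_beside[OF grid_rev[OF assms(1)] grid_map_rev[OF assms(2)]]
    pairs_rev[OF assms(1)] pairs_map_rev[OF assms(2)]
  unfolding contains_grid_def fold_beside_def by blast

text \<open>The choice between the two merges is visible in every word containing the result: the pair that
  is horizontal after one merge is vertical after the other.\<close>

lemma separated_stack_fold_beside:
  assumes X: "grid R c X" and Y: "grid R c Y" and "R \<ge> 1" "c \<ge> 1"
    and xs: "contains_grid d xs (stack X Y)" and ys: "contains_grid d ys (fold_beside X Y)"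
  shows "separated d xs ys"
proof -
  note g = X[unfolded grid_def] Y[unfolded grid_def]
  let ?e = "{X ! (R - 1) ! (c - 1), Y ! 0 ! (c - 1)}"
  have "?e \<in> vertical_pairs (stack X Y)"
    using g \<open>R \<ge> 1\<close> \<open>c \<ge> 1\<close>
    by (intro vertical_pairsI[of "R - 1" _ "c - 1"]) (auto simp: stack_def nth_append)
  moreover have "?e \<in> horizontal_pairs (fold_beside X Y)"
    using g \<open>R \<ge> 1\<close> \<open>c \<ge> 1\<close>
    by (intro horizontal_pairsI[of 0 _ "c - 1"])
      (auto simp: fold_beside_def beside_def nth_append rev_nth)
  ultimately show ?thesis
    using xs ys unfolding contains_grid_def separated_def by blast
qed

text \<open>The vertex in front of the grid is adjacent to the first entry of the first row, and at distance
  \<open>d\<close> from it once the row is reversed.\<close>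

lemma separated_row_reversal:
  assumes X: "grid R d X" and "R \<ge> 1" "d \<ge> 1" "ws \<noteq> []"
  shows "separated d (ws @ concat X @ us) (ws @ concat (map rev X) @ vs)"
proof -
  have n: "concat X ! 0 = X ! 0 ! 0" "concat (map rev X) ! (d - 1) = X ! 0 ! 0"
    using nth_concat_grid[OF X, of 0 0] nth_concat_grid[OF grid_map_rev[OF X], of 0 "d - 1"]
      \<open>R \<ge> 1\<close> \<open>d \<ge> 1\<close> X by (auto simp: rev_nth grid_def)
  have len: "length (concat X) \<ge> d" "length (concat (map rev X)) \<ge> d"
    using length_concat_grid[OF X] length_concat_grid[OF grid_map_rev[OF X]] \<open>R \<ge> 1\<close>
    by auto
  have pair: "{last ws, ys ! (k - 1)} \<in> gap_pairs k (ws @ ys @ vs)"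
    if "k \<ge> 1" "k \<le> length ys" for k ys vs
  proof -
    have "length ws - 1 + k = length ws + (k - 1)"
      using that \<open>ws \<noteq> []\<close> by (cases ws) auto
    then show ?thesis
      using that \<open>ws \<noteq> []\<close>
      by (intro gap_pairsI[of "length ws - 1"]) (auto simp: nth_append last_conv_nth)
  qed
  have "{last ws, X ! 0 ! 0} \<in> gap_pairs 1 (ws @ concat X @ us)"
    using pair[of 1 "concat X" us] n(1) len(1) \<open>d \<ge> 1\<close> by (simp del: length_concat)
  moreover have "{last ws, X ! 0 ! 0} \<in> gap_pairs d (ws @ concat (map rev X) @ vs)"
    using pair[of d "concat (map rev X)" vs] n(2) len(2) \<open>d \<ge> 1\<close> by (simp del: length_concat)
  ultimately show ?thesis unfolding separated_def by blast
qed

section \<open>Counting the words produced by merging\<close>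

text \<open>One bit per full-width grid: the grids are written one after the other, each as it is or with all its
  rows reversed.\<close>

lemma full_width_family:
  assumes "finite I" "\<And>i. i \<in> I \<Longrightarrow> grid R d (C i)" "R \<ge> 1" "d \<ge> 2"
    and "simple_mset (\<Sum>i\<in>I. mset (concat (C i)))"
  shows "\<exists>F. separated_family d (\<Sum>i\<in>I. mset (concat (C i))) F \<and> 2 ^ card I \<le> card F \<and>
    (\<forall>xs\<in>F. \<forall>i\<in>I. contains_grid d xs (C i))"
  using assms(1,2,5)
proof (induction I rule: finite_induct)
  case empty
  show ?case
    using separated_family_singleton[of d "[]"] by (intro exI[of _ "{[]}"]) auto
next
  case (insert j I)
  let ?M = "\<Sum>i\<in>I. mset (concat (C i))"
  let ?X = "C j"
  have X: "grid R d ?X" using insert by simp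
  have simple: "simple_mset (mset (concat ?X))" "simple_mset ?M"
    using insert.prems(2) insert.hyps simple_mset_addD[of "mset (concat ?X)" ?M] by auto
  obtain F where F: "separated_family d ?M F" "2 ^ card I \<le> card F"
      "\<forall>xs\<in>F. \<forall>i\<in>I. contains_grid d xs (C i)"
    using insert.IH insert.prems(1) simple by blast
  let ?E = "{concat ?X, concat (map rev ?X)}"
  have sep: "separated d (ws @ concat ?X) (ws @ concat (map rev ?X))" if "ws \<noteq> []" for ws
    using separated_row_reversal[OF X \<open>R \<ge> 1\<close> _ that, of "[]" "[]"] \<open>d \<ge> 2\<close> by simp
  have E: "separated_family d (mset (concat ?X)) ?E"
    using sep separated_sym unfolding separated_family_def
    by (auto simp: mset_concat_map_rev simp del: mset_concat)
  have "concat ?X ! 0 \<noteq> concat (map rev ?X) ! 0"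
  proof -
    have g: "concat ?X ! 0 = ?X ! 0 ! 0" "concat ?X ! (d - 1) = ?X ! 0 ! (d - 1)"
        "concat (map rev ?X) ! 0 = ?X ! 0 ! (d - 1)"
      using nth_concat_grid[OF X, of 0 0] nth_concat_grid[OF X, of 0 "d - 1"]
        nth_concat_grid[OF grid_map_rev[OF X], of 0 0] \<open>R \<ge> 1\<close> \<open>d \<ge> 2\<close> X
      by (auto simp: rev_nth grid_def)
    have "length (concat ?X) \<ge> d" using length_concat_grid[OF X] \<open>R \<ge> 1\<close> by simp
    then have "concat ?X ! 0 \<noteq> concat ?X ! (d - 1)"
      using distinct_if_simple_mset[OF simple(1)] \<open>d \<ge> 2\<close>
      by (subst nth_eq_iff_index_eq) (auto simp del: length_concat length_greater_0_conv)
    then show ?thesis using g by simp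
  qed
  then have "card ?E = 2" by (metis card_2_iff)
  then have "2 ^ card (insert j I) \<le> card (juxtapose ?E F)"
    using separated_family_juxtapose(2)[OF E F(1)] F(2) insert.hyps by simp
  moreover have "contains_grid d xs (C i)" if zs: "xs \<in> juxtapose ?E F" and i: "i \<in> insert j I" for xs i
  proof -
    obtain x y where xy: "xs = x @ y" "x \<in> ?E" "y \<in> F"
      using zs unfolding in_juxtapose_iff by blast
    show ?thesis
    proof (cases "i = j")
      case True
      then have "contains_grid d x (C i)"
        using xy(2) X contains_grid_concat contains_grid_concat_map_rev by blast
      then show ?thesis using contains_grid_append[of d x "C i" "[]" y] xy by simp
    next
      case False
      then have "contains_grid d y (C i)" using F(3) xy i by blast
      then show ?thesis using contains_grid_append[of d y "C i" x "[]"] xy by simp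
    qed
  qed
  ultimately show ?case
    using separated_family_juxtapose(1)[OF E F(1)] insert.hyps
    by (intro exI[of _ "juxtapose ?E F"]) auto
qed

lemma grid_of_list: "length fs = R * c \<Longrightarrow> \<exists>X. grid R c X \<and> concat X = fs"
proof (induction R arbitrary: fs)
  case 0
  then show ?case by (intro exI[of _ "[]"]) (auto simp: grid_def)
next
  case (Suc R)
  have "length (drop c fs) = R * c" using Suc.prems by simp
  then obtain X where "grid R c X" "concat X = drop c fs"
    using Suc.IH by blast
  then show ?case using Suc.prems
    by (intro exI[of _ "take c fs # X"]) (auto simp: grid_def nth_Cons split: nat.splits)
qed

text \<open>Only \<open>R * (d - c)\<close> of the letters \<open>fs\<close> are used for padding; the others follow behind the grid. Using
  a number that does not depend on the width \<open>c\<close> keeps the count of extra vertices uniform.\<close>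

lemma pad_grid:
  assumes X: "grid R c X" and "c \<le> d" and fs: "length fs = R * d"
  shows "\<exists>xs. mset xs = mset (concat X) + mset fs \<and> contains_grid d xs X"
proof -
  let ?k = "R * (d - c)"
  have "?k \<le> length fs" using fs by simp
  then obtain G where G: "grid R (d - c) G" "concat G = take ?k fs"
    using grid_of_list[of "take ?k fs" R "d - c"] by auto
  have Z: "grid R d (beside X G)" using grid_beside[OF X G(1)] \<open>c \<le> d\<close> by simp
  have "contains_grid d (concat (beside X G)) X"
    using contains_grid_concat[OF Z] pairs_beside(1,3)[OF X G(1)]
    unfolding contains_grid_def by blast
  then have "contains_grid d (concat (beside X G) @ drop ?k fs) X"
    using contains_grid_append[of d _ X "[]"] by simp
  moreover have "mset (concat (beside X G) @ drop ?k fs) = mset (concat X) + mset fs"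
    using mset_concat_beside[of X G] X G
    by (simp add: grid_def del: mset_concat) (metis append_take_drop_id mset_append)
  ultimately show ?thesis by blast
qed

lemma sum_over_pairing:
  fixes h :: "'a \<Rightarrow> 'b::comm_monoid_add"
  assumes "finite I" "A \<subseteq> I" "bij_betw f A (I - A)"
  shows "(\<Sum>i\<in>I. h i) = (\<Sum>i\<in>A. h i + h (f i))"
proof -
  have "(\<Sum>i\<in>I. h i) = (\<Sum>i\<in>I - A. h i) + (\<Sum>i\<in>A. h i)"
    using assms(1,2) by (rule sum.subset_diff[rotated])
  also have "(\<Sum>i\<in>I - A. h i) = (\<Sum>i\<in>A. h (f i))"
    using sum.reindex_bij_betw[OF assms(3)] by metis
  finally show ?thesis by (simp add: sum.distrib add.commute)
qed

text \<open>Prescribing that exactly half of \<open>2 * p\<close> pairs are stacked loses at most a factor \<open>2 * p\<close> out of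
  \<open>4 ^ p\<close> choices.\<close>

lemma central_binomial_mult_ge:
  assumes "p \<ge> 1"
  shows "4 ^ p \<le> ((2 * p) choose p) * (2 * p)"
proof -
  have "4 ^ p \<le> real ((2 * p) choose p) * (2 * real p)"
    using central_binomial_lower_bound[of p] assms by (simp add: field_simps)
  also have "\<dots> = real (((2 * p) choose p) * (2 * p))" by simp
  finally have "real (4 ^ p) \<le> real (((2 * p) choose p) * (2 * p))" by simp
  then show ?thesis by (rule of_nat_le_iff[THEN iffD1])
qed

lemma odd_le_power3: "2 * t + 1 \<le> 3 ^ Suc t" for t :: nat
  by (induction t) auto

text \<open>The induction is on the number \<open>g\<close> of doublings still needed to reach full width, and inside it on
  \<open>t\<close>. Of the \<open>4 ^ Suc t\<close> grids, \<open>2 * 4 ^ t\<close> pairs are formed. Stacking half of them leaves \<open>4 ^ t\<close> grids of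
  the same width and twice the height, for the inner induction hypothesis; the other half are \<open>4 ^ t\<close>
  grids of twice the width, for the outer one. The extra vertices needed are
  \<open>2 * R * d * 3 ^ t\<close> and \<open>R * d * 3 ^ t\<close>, together \<open>R * d * 3 ^ Suc t\<close>. If each part loses \<open>3 ^ Suc t\<close> bits, then
  together with the at most \<open>2 * t + 1 \<le> 3 ^ Suc t\<close> bits lost by fixing the number of stacked
  pairs this makes \<open>3 ^ Suc (Suc t)\<close>.\<close>

lemma merging_family:
  assumes "j + g = l" "l \<ge> 1" "finite I" "card I = 4 ^ t" "R \<ge> 1"
    and "\<And>i. i \<in> I \<Longrightarrow> grid R (2 ^ j) (C i)"
    and "length fs = R * 2 ^ l * 3 ^ t"
    and "simple_mset ((\<Sum>i\<in>I. mset (concat (C i))) + mset fs)"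
  shows "\<exists>F. separated_family (2 ^ l) ((\<Sum>i\<in>I. mset (concat (C i))) + mset fs) F \<and>
    2 ^ 4 ^ t \<le> card F * 2 ^ 3 ^ Suc t \<and>
    (\<forall>xs\<in>F. \<forall>i\<in>I. contains_grid (2 ^ l) xs (C i))"
  using assms(1,3-)
proof (induction g arbitrary: j t I R C fs)
  case 0
  let ?d = "2 ^ l :: nat" and ?M = "\<Sum>i\<in>I. mset (concat (C i))"
  have d: "?d \<ge> 2" using \<open>l \<ge> 1\<close> by (metis power_increasing one_le_numeral power_one_right)
  have "simple_mset ?M" using 0 simple_mset_addD by blast
  then obtain F where F: "separated_family ?d ?M F" "2 ^ card I \<le> card F"
      "\<forall>xs\<in>F. \<forall>i\<in>I. contains_grid ?d xs (C i)"
    using full_width_family[of I R ?d C] 0 d by auto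
  let ?G = "juxtapose F {fs}"
  have "card ?G = card F"
    using separated_family_juxtapose(2)[OF F(1) separated_family_singleton] by simp
  then have "2 ^ 4 ^ t \<le> card ?G" using F(2) 0 by simp
  then have "2 ^ 4 ^ t * 1 \<le> card ?G * 2 ^ 3 ^ Suc t"
    by (intro mult_le_mono) auto
  moreover have "contains_grid ?d xs (C i)" if "xs \<in> ?G" "i \<in> I" for xs i
  proof -
    from that obtain x where "xs = x @ fs" "x \<in> F"
      unfolding in_juxtapose_iff by blast
    then show ?thesis using F(3) that contains_grid_append[of ?d x "C i" "[]" fs] by simp
  qed
  ultimately show ?case
    using separated_family_juxtapose(1)[OF F(1) separated_family_singleton, of fs] by auto
next
  case (Suc g)
  note outer = Suc.IH
  have jl: "j + Suc g = l" by fact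
  show ?case using Suc.prems(2-)
  proof (induction t arbitrary: I R C fs)
    case 0
    then obtain i where I: "I = {i}" by (auto simp: card_1_singleton_iff)
    have "(2::nat) ^ j \<le> 2 ^ l" using jl by (intro power_increasing) auto
    then obtain xs where "mset xs = mset (concat (C i)) + mset fs" "contains_grid (2 ^ l) xs (C i)"
      using pad_grid[of R "2 ^ j" "C i" "2 ^ l" fs] 0 I by auto
    then show ?case
      using separated_family_singleton[of "2 ^ l" xs] I by (intro exI[of _ "{xs}"]) auto
  next
    case (Suc t)
    let ?d = "2 ^ l :: nat"
    let ?p = "4 ^ t :: nat"
    have d: "?d \<ge> 2" using \<open>l \<ge> 1\<close> by (metis power_increasing one_le_numeral power_one_right)
    let ?M = "(\<Sum>i\<in>I. mset (concat (C i))) + mset fs"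
    obtain A where A: "A \<subseteq> I" "card A = 2 * ?p" "finite A"
      using obtain_subset_with_card_n[of "2 * ?p" I] Suc.prems(2) by auto
    \<comment> \<open>The grid with index \<open>i\<close> in \<open>A\<close> is merged with the one with index \<open>f i\<close> outside \<open>A\<close>.\<close>
    have "card (I - A) = card A"
      using A Suc.prems by (simp add: card_Diff_subset)
    then obtain f where f: "bij_betw f A (I - A)"
      using A Suc.prems(1) by (metis finite_Diff finite_same_card_bij)
    have fI: "f i \<in> I" if "i \<in> A" for i using f that bij_betwE by fastforce
    define S where "S i = stack (C i) (C (f i))" for i
    define B where "B i = fold_beside (C i) (C (f i))" for i
    have gridC: "grid R (2 ^ j) (C i)" "grid R (2 ^ j) (C (f i))" if "i \<in> A" for i
      using that A fI Suc.prems(4) by auto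
    have gridS: "grid (2 * R) (2 ^ j) (S i)" and gridB: "grid R (2 ^ Suc j) (B i)"
      if "i \<in> A" for i
      using grid_stack[OF gridC[OF that]] grid_fold_beside[OF gridC[OF that]]
      by (simp_all add: S_def B_def mult_2)
    have msetS: "mset (concat (S i)) = mset (concat (C i)) + mset (concat (C (f i)))"
      and msetB: "mset (concat (B i)) = mset (concat (C i)) + mset (concat (C (f i)))"
      if "i \<in> A" for i
      unfolding S_def B_def
      using mset_concat_stack mset_concat_fold_beside[OF gridC[OF that]] by blast+
    define k where "k = 2 * R * 2 ^ l * 3 ^ t"
    have lenfs: "length (take k fs) = 2 * R * 2 ^ l * 3 ^ t" "length (drop k fs) = R * 2 ^ l * 3 ^ t"
      using Suc.prems(5) by (auto simp: k_def)
    have M: "?M = ((\<Sum>i\<in>T. mset (concat (S i))) + mset (take k fs)) +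
        ((\<Sum>i\<in>A - T. mset (concat (B i))) + mset (drop k fs))" if "T \<subseteq> A" for T
    proof -
      let ?h = "\<lambda>i. mset (concat (C i)) + mset (concat (C (f i)))"
      have "(\<Sum>i\<in>I. mset (concat (C i))) = (\<Sum>i\<in>A. ?h i)"
        by (rule sum_over_pairing[OF Suc.prems(1) A(1) f])
      also have "\<dots> = (\<Sum>i\<in>A - T. ?h i) + (\<Sum>i\<in>T. ?h i)"
        using A(3) that by (rule sum.subset_diff[rotated])
      also have "(\<Sum>i\<in>A - T. ?h i) = (\<Sum>i\<in>A - T. mset (concat (B i)))"
        by (intro sum.cong) (auto simp: msetB simp del: mset_concat)
      also have "(\<Sum>i\<in>T. ?h i) = (\<Sum>i\<in>T. mset (concat (S i)))"
        using that by (intro sum.cong) (auto simp: msetS simp del: mset_concat)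
      moreover have "mset fs = mset (take k fs) + mset (drop k fs)"
        by (metis append_take_drop_id mset_append)
      ultimately show ?thesis by (simp add: ac_simps del: mset_concat)
    qed
    let ?\<T> = "{T. T \<subseteq> A \<and> card T = ?p}"
    \<comment> \<open>\<open>P T G\<close>: the words in \<open>G\<close> arise from stacking precisely the pairs with index in \<open>T\<close>.\<close>
    define P where "P T G \<longleftrightarrow> separated_family ?d ?M G \<and>
        2 ^ (2 * 4 ^ t) \<le> card G * 2 ^ (2 * 3 ^ Suc t) \<and>
        (\<forall>xs\<in>G. (\<forall>i\<in>T. contains_grid ?d xs (S i)) \<and> (\<forall>i\<in>A - T. contains_grid ?d xs (B i)))"
      for T G
    have "\<exists>G. P T G" if T: "T \<in> ?\<T>" for T
    proof -
      have T': "T \<subseteq> A" "card T = 4 ^ t" "finite T" "card (A - T) = 4 ^ t" "finite (A - T)"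
        using T A by (auto simp: card_Diff_subset finite_subset)
      let ?M1 = "(\<Sum>i\<in>T. mset (concat (S i))) + mset (take k fs)"
      let ?M2 = "(\<Sum>i\<in>A - T. mset (concat (B i))) + mset (drop k fs)"
      have simple: "simple_mset ?M1" "simple_mset ?M2"
        using Suc.prems(6) M[OF T'(1)] simple_mset_addD[of ?M1 ?M2] by auto
      obtain F1 where F1: "separated_family ?d ?M1 F1" "2 ^ 4 ^ t \<le> card F1 * 2 ^ 3 ^ Suc t"
          "\<forall>xs\<in>F1. \<forall>i\<in>T. contains_grid ?d xs (S i)"
        using Suc.IH[of T "2 * R" S "take k fs"] T' gridS simple lenfs Suc.prems(3) by auto
      obtain F2 where F2: "separated_family ?d ?M2 F2" "2 ^ 4 ^ t \<le> card F2 * 2 ^ 3 ^ Suc t"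
          "\<forall>xs\<in>F2. \<forall>i\<in>A - T. contains_grid ?d xs (B i)"
        using outer[of "Suc j" "A - T" t R B "drop k fs"] jl T' gridB simple lenfs Suc.prems(3)
        by auto
      let ?G = "juxtapose F1 F2"
      have "2 ^ 4 ^ t * 2 ^ 4 ^ t \<le> (card F1 * 2 ^ 3 ^ Suc t) * (card F2 * 2 ^ 3 ^ Suc t)"
        using F1(2) F2(2) by (rule mult_le_mono)
      then have "2 ^ (2 * 4 ^ t) \<le> card ?G * 2 ^ (2 * 3 ^ Suc t)"
        unfolding separated_family_juxtapose(2)[OF F1(1) F2(1)] mult_2 power_add
        by (simp only: ac_simps)
      moreover have "contains_grid ?d (x @ y) (S i)" if "x \<in> F1" "i \<in> T" for x y i
        using F1(3) that contains_grid_append[of ?d x "S i" "[]" y] by simp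
      moreover have "contains_grid ?d (x @ y) (B i)" if "y \<in> F2" "i \<in> A - T" for x y i
        using F2(3) that contains_grid_append[of ?d y "B i" x "[]"] by simp
      ultimately show ?thesis
        unfolding P_def M[OF T'(1)]
        using separated_family_juxtapose(1)[OF F1(1) F2(1)]
        by (intro exI[of _ ?G]) (auto simp: juxtapose_def)
    qed
    then obtain G where "\<forall>T\<in>?\<T>. P T (G T)"
      using bchoice[of ?\<T> P] by blast
    then have G: "\<And>T. T \<in> ?\<T> \<Longrightarrow> separated_family ?d ?M (G T)"
        "\<And>T. T \<in> ?\<T> \<Longrightarrow> 2 ^ (2 * 4 ^ t) \<le> card (G T) * 2 ^ (2 * 3 ^ Suc t)"
        "\<And>T xs i. T \<in> ?\<T> \<Longrightarrow> xs \<in> G T \<Longrightarrow> i \<in> T \<Longrightarrow> contains_grid ?d xs (S i)"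
        "\<And>T xs i. T \<in> ?\<T> \<Longrightarrow> xs \<in> G T \<Longrightarrow> i \<in> A - T \<Longrightarrow> contains_grid ?d xs (B i)"
      unfolding P_def by blast+
    have sep: "separated ?d xs ys"
      if "T \<in> ?\<T>" "T' \<in> ?\<T>" "T \<noteq> T'" "xs \<in> G T" "ys \<in> G T'" for T T' xs ys
    proof -
      \<comment> \<open>Sets of equal size are not nested, so some pair is stacked for \<open>T\<close> but not for \<open>T'\<close>.\<close>
      have "finite T'" "card T = card T'" using that A finite_subset by auto
      then have "\<not> T \<subseteq> T'" using card_subset_eq that(3) by blast
      then obtain i where i: "i \<in> T" "i \<notin> T'" by blast
      then have "i \<in> A" using that by blast
      then show ?thesis
        using separated_stack_fold_beside[OF gridC[OF \<open>i \<in> A\<close>] \<open>R \<ge> 1\<close>, of ?d xs ys]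
          G(3)[OF that(1,4) i(1)] G(4)[OF that(2,5), of i] i
        by (simp add: S_def B_def)
    qed
    let ?F = "\<Union>T\<in>?\<T>. G T"
    have family: "separated_family ?d ?M ?F" and "card ?F = (\<Sum>T\<in>?\<T>. card (G T))"
      using separated_family_UN[of ?\<T> ?d ?M G, OF _ d Suc.prems(6) G(1) sep] A(3) by simp_all
    then have "card ?F * 2 ^ (2 * 3 ^ Suc t) = (\<Sum>T\<in>?\<T>. card (G T) * 2 ^ (2 * 3 ^ Suc t))"
      by (simp add: sum_distrib_right)
    also have "\<dots> \<ge> (\<Sum>T\<in>?\<T>. 2 ^ (2 * 4 ^ t))"
      using G(2) by (intro sum_mono) blast
    also have "(\<Sum>T\<in>?\<T>. 2 ^ (2 * 4 ^ t)) = ((2 * ?p) choose ?p) * 2 ^ (2 * 4 ^ t)"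
      using n_subsets[OF A(3), of ?p] A(2) by simp
    finally have count: "((2 * ?p) choose ?p) * 2 ^ (2 * 4 ^ t) \<le> card ?F * 2 ^ (2 * 3 ^ Suc t)" .
    have "2 * ?p = 2 ^ (2 * t + 1)" by (simp add: power_mult)
    also have "\<dots> \<le> 2 ^ 3 ^ Suc t" using odd_le_power3 by (intro power_increasing) auto
    finally have p: "2 * ?p \<le> 2 ^ 3 ^ Suc t" .
    let ?c = "(2 * ?p) choose ?p" and ?K = "2 ^ (2 * 4 ^ t) :: nat"
    have "(2::nat) ^ 4 ^ Suc t = 2 ^ (2 * ?p + 2 * ?p)" by simp
    also have "\<dots> = 4 ^ ?p * ?K" unfolding power_add by (simp add: power_mult)
    also have "\<dots> \<le> ?c * (2 * ?p) * ?K"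
      by (rule mult_le_mono1, rule central_binomial_mult_ge) simp
    also have "\<dots> = ?c * ?K * (2 * ?p)" by (simp only: ac_simps)
    also have "\<dots> \<le> (card ?F * 2 ^ (2 * 3 ^ Suc t)) * 2 ^ 3 ^ Suc t"
      using count p by (rule mult_le_mono)
    also have "\<dots> = card ?F * 2 ^ (2 * 3 ^ Suc t + 3 ^ Suc t)"
      by (simp only: power_add mult.assoc)
    also have "2 * 3 ^ Suc t + 3 ^ Suc t = (3::nat) ^ Suc (Suc t)" by simp
    finally have size: "2 ^ 4 ^ Suc t \<le> card ?F * 2 ^ 3 ^ Suc (Suc t)" .
    have "contains_grid ?d xs (C i)" if xs: "xs \<in> ?F" and i: "i \<in> I" for xs i
    proof -
      obtain T where T: "T \<in> ?\<T>" "xs \<in> G T" using xs by blast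
      have both: "contains_grid ?d xs (C a) \<and> contains_grid ?d xs (C (f a))" if "a \<in> A" for a
      proof (cases "a \<in> T")
        case True
        then show ?thesis using G(3)[OF T] contains_grid_stackD unfolding S_def by blast
      next
        case False
        then show ?thesis
          using G(4)[OF T, of a] that contains_grid_fold_besideD[OF gridC[OF that]]
          unfolding B_def by blast
      qed
      show ?thesis
      proof (cases "i \<in> A")
        case False
        then obtain a where "a \<in> A" "i = f a"
          using f i by (auto simp: bij_betw_def image_iff)
        then show ?thesis using both by blast
      qed (use both in blast)
    qed
    then show ?case using family size by blast
  qed
qed

lemma simple_mset_set: "simple_mset (mset_set A)"
  by (cases "finite A") (auto simp: simple_mset_def count_mset_set')

section \<open>Cutting the ground set into blocks\<close>

lemma block_family:
  fixes S :: "nat set"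
  assumes "l \<ge> 1" "finite S" "card S = 4 ^ t + 2 ^ l * 3 ^ t"
  shows "\<exists>F. separated_family (2 ^ l) (mset_set S) F \<and> 2 ^ 4 ^ t \<le> card F * 2 ^ 3 ^ Suc t"
proof -
  obtain A where A: "A \<subseteq> S" "card A = 4 ^ t" "finite A"
    using obtain_subset_with_card_n[of "4 ^ t" S] assms(3) by auto
  define fs where "fs = sorted_list_of_set (S - A)"
  have "mset_set S = mset_set (A \<union> (S - A))" using A by (simp add: Un_absorb1)
  also have "\<dots> = mset_set A + mset_set (S - A)"
    using A \<open>finite S\<close> by (intro mset_set_Union) auto
  also have "mset_set A = (\<Sum>i\<in>A. mset (concat [[i]]))" by (simp flip: sum_unfold_sum_mset)
  also have "mset_set (S - A) = mset fs" using \<open>finite S\<close> mset_set_set[of fs] by (simp add: fs_def)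
  finally have M: "mset_set S = (\<Sum>i\<in>A. mset (concat [[i]])) + mset fs" .
  have "length fs = 1 * 2 ^ l * 3 ^ t"
    using A assms by (simp add: fs_def card_Diff_subset)
  then show ?thesis
    using merging_family[of 0 l l A t 1 "\<lambda>i. [[i]]" fs] A \<open>l \<ge> 1\<close> simple_mset_set[of S]
    unfolding M by (auto simp: grid_def)
qed

lemma block_sequence_family:
  fixes S :: "nat set"
  assumes "l \<ge> 1" "finite S" "card S = q * (4 ^ t + 2 ^ l * 3 ^ t)"
  shows "\<exists>F. separated_family (2 ^ l) (mset_set S) F \<and>
    2 ^ (q * 4 ^ t) \<le> card F * 2 ^ (q * 3 ^ Suc t)"
  using assms(2,3)
proof (induction q arbitrary: S)
  case 0
  then show ?case
    using separated_family_singleton[of "2 ^ l" "[]"] by (intro exI[of _ "{[]}"]) auto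
next
  case (Suc q)
  obtain A where A: "A \<subseteq> S" "card A = 4 ^ t + 2 ^ l * 3 ^ t" "finite A"
    using obtain_subset_with_card_n[of "4 ^ t + 2 ^ l * 3 ^ t" S] Suc.prems by auto
  have "card (S - A) = q * (4 ^ t + 2 ^ l * 3 ^ t)"
    using A Suc.prems by (simp add: card_Diff_subset)
  then obtain G where G: "separated_family (2 ^ l) (mset_set (S - A)) G"
      "2 ^ (q * 4 ^ t) \<le> card G * 2 ^ (q * 3 ^ Suc t)"
    using Suc.IH[of "S - A"] Suc.prems(1) by auto
  obtain F where F: "separated_family (2 ^ l) (mset_set A) F"
      "2 ^ 4 ^ t \<le> card F * 2 ^ 3 ^ Suc t"
    using block_family[OF \<open>l \<ge> 1\<close> A(3,2)] by blast
  have "mset_set S = mset_set (A \<union> (S - A))" using A by (simp add: Un_absorb1)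
  also have "\<dots> = mset_set A + mset_set (S - A)"
    using A Suc.prems(1) by (intro mset_set_Union) auto
  finally have M: "mset_set S = mset_set A + mset_set (S - A)" .
  have "2 ^ (Suc q * 4 ^ t) = 2 ^ 4 ^ t * (2::nat) ^ (q * 4 ^ t)" by (simp add: power_add)
  also have "\<dots> \<le> (card F * 2 ^ 3 ^ Suc t) * (card G * 2 ^ (q * 3 ^ Suc t))"
    using F(2) G(2) by (rule mult_le_mono)
  also have "\<dots> = card (juxtapose F G) * 2 ^ (Suc q * 3 ^ Suc t)"
    unfolding separated_family_juxtapose(2)[OF F(1) G(1)] mult_Suc power_add
    by (simp only: ac_simps)
  finally show ?case
    unfolding M using separated_family_juxtapose(1)[OF F(1) G(1)] by blast
qed

section \<open>From separated words to Hamiltonian paths\<close>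

lemma edges_path_graph: "snd (path_graph xs) = gap_pairs 1 xs"
  by (auto simp: path_graph_def gap_pairs_def)

lemma contains_cycle_if_gap:
  assumes "e \<in> gap_pairs d ys" "e \<in> snd G" "gap_pairs 1 ys \<subseteq> snd G" "set ys \<subseteq> fst G"
    and "distinct ys" "d \<ge> 2"
  shows "contains_cycle (d + 1) G"
proof -
  obtain i where i: "e = {ys ! i, ys ! (i + d)}" "i + d < length ys"
    using assms(1) by (auto simp: gap_pairs_def)
  define zs where "zs = take (Suc d) (drop i ys)"
  have len: "length zs = Suc d" using i(2) by (simp add: zs_def)
  have nth: "zs ! k = ys ! (i + k)" if "k \<le> d" for k
    using that i(2) by (simp add: zs_def)
  have "distinct zs" using \<open>distinct ys\<close> by (simp add: zs_def)
  moreover have "set zs \<subseteq> fst G"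
    using \<open>set ys \<subseteq> fst G\<close> unfolding zs_def by (meson set_drop_subset set_take_subset subset_trans)
  moreover have "{zs ! k, zs ! (Suc k mod length zs)} \<in> snd G" if "k < length zs" for k
  proof (cases "k = d")
    case True
    then show ?thesis using i len nth[of 0] nth[of d] assms(2) by (simp add: insert_commute)
  next
    case False
    then have "{zs ! k, zs ! (Suc k mod length zs)} = {ys ! (i + k), ys ! (i + k + 1)}"
      using that len nth[of k] nth[of "Suc k"] by simp
    also have "\<dots> \<in> gap_pairs 1 ys"
      using False that len i(2) by (intro gap_pairsI[of "i + k"]) auto
    finally show ?thesis using assms(3) by blast
  qed
  ultimately show ?thesis
    unfolding contains_cycle_def subgraph_def cycle_graph_def using len \<open>d \<ge> 2\<close>
    by (auto intro!: exI[of _ zs])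
qed

lemma contains_cycle_if_separated:
  assumes "separated d xs ys" "distinct xs" "distinct ys" "d \<ge> 2"
  shows "contains_cycle (d + 1) (graph_union (path_graph xs) (path_graph ys))"
proof -
  let ?G = "graph_union (path_graph xs) (path_graph ys)"
  have G: "snd ?G = gap_pairs 1 xs \<union> gap_pairs 1 ys" "fst ?G = set xs \<union> set ys"
    by (auto simp: graph_union_def edges_path_graph) (auto simp: path_graph_def)
  then show ?thesis
    using assms contains_cycle_if_gap[of _ d xs ?G] contains_cycle_if_gap[of _ d ys ?G]
    unfolding separated_def by blast
qed

lemma path_graph_in_hamiltonian_paths:
  assumes "distinct xs" "set xs = {1..n}"
  shows "path_graph xs \<in> hamiltonian_paths (complete_graph n)"
proof -
  have "{xs ! i, xs ! Suc i} \<subseteq> {1..n} \<and> card {xs ! i, xs ! Suc i} = 2" if "Suc i < length xs" for i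
  proof -
    have "xs ! i \<noteq> xs ! Suc i" using assms(1) that by (simp add: nth_eq_iff_index_eq)
    moreover have "xs ! i \<in> set xs" "xs ! Suc i \<in> set xs" using that by auto
    ultimately show ?thesis using assms(2) by auto
  qed
  then show ?thesis
    using assms unfolding hamiltonian_paths_def complete_graph_def subgraph_def path_graph_def
    by auto
qed

lemma card_le_max_cycle_union_family:
  "F \<in> cycle_union_families k n \<Longrightarrow> card F \<le> max_cycle_union_family k n"
  unfolding max_cycle_union_family_def by (simp add: finite_cycle_union_families)

text \<open>The vertex \<open>n\<close> starts every path, as the nonempty prefix that separation asks for. It is followed by \<open>q\<close>
  blocks, and finally by the fewer than one block of left-over vertices in a fixed order.\<close>

lemma max_cycle_union_family_ge:
  fixes l n t :: nat
  assumes "l \<ge> 1" "n \<ge> 1"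
  defines "q \<equiv> (n - 1) div (4 ^ t + 2 ^ l * 3 ^ t)"
  shows "2 ^ (q * 4 ^ t) \<le> max_cycle_union_family (2 ^ l + 1) n * 2 ^ (q * 3 ^ Suc t)"
proof -
  let ?d = "2 ^ l :: nat"
  define b where "b = q * (4 ^ t + 2 ^ l * 3 ^ t)"
  have d: "?d \<ge> 2" using \<open>l \<ge> 1\<close> by (metis power_increasing one_le_numeral power_one_right)
  have b: "b \<le> n - 1" unfolding b_def q_def by (rule div_times_less_eq_dividend)
  obtain F where F: "separated_family ?d (mset_set {1..b}) F"
      "2 ^ (q * 4 ^ t) \<le> card F * 2 ^ (q * 3 ^ Suc t)"
    using block_sequence_family[OF \<open>l \<ge> 1\<close>, of "{1..b}" q t] by (auto simp: b_def)
  \<comment> \<open>The full path: first vertex, blocks, left-over vertices.\<close>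
  define ext where "ext xs = [n] @ xs @ [Suc b..<n]" for xs
  have ext: "distinct (ext xs)" "set (ext xs) = {1..n}" if "xs \<in> F" for xs
  proof -
    have M: "mset xs = mset_set {1..b}" using F(1) that by (simp add: separated_family_def)
    have "distinct xs" using distinct_if_simple_mset[of xs] simple_mset_set[of "{1..b}"] M by simp
    moreover have "set xs = {1..b}" using arg_cong[OF M, of set_mset] by simp
    ultimately have xs: "distinct xs" "set xs = {1..b}" by blast+
    show "distinct (ext xs)" using xs b \<open>n \<ge> 1\<close> by (auto simp: ext_def)
    have "set (ext xs) = insert n ({1..b} \<union> {Suc b..<n})" using xs(2) by (simp add: ext_def)
    also have "\<dots> = {1..n}" using b \<open>n \<ge> 1\<close> by (intro set_eqI) (simp, linarith)
    finally show "set (ext xs) = {1..n}" .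
  qed
  have sep: "separated ?d (ext xs) (ext ys)" if "xs \<in> F" "ys \<in> F" "xs \<noteq> ys" for xs ys
  proof -
    have "separated ?d ([n] @ xs) ([n] @ ys)"
      using F(1) that unfolding separated_family_def by blast
    from separated_append[OF this, of "[]"] show ?thesis by (simp add: ext_def)
  qed
  let ?P = "\<lambda>xs. path_graph (ext xs)"
  have "inj_on ?P F"
  proof (rule inj_onI, rule ccontr)
    fix xs ys assume xs: "xs \<in> F" "ys \<in> F" "?P xs = ?P ys" "xs \<noteq> ys"
    then have "gap_pairs 1 (ext xs) = gap_pairs 1 (ext ys)" by (metis edges_path_graph)
    then show False
      using separated_imp_adjacencies_differ[OF sep[OF xs(1,2,4)]] ext xs d by blast
  qed
  then have "card F = card (?P ` F)" by (simp add: card_image)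
  moreover have "?P ` F \<in> cycle_union_families (?d + 1) n"
  proof -
    have "contains_cycle (?d + 1) (graph_union (?P xs) (?P ys))"
      if "xs \<in> F" "ys \<in> F" "?P xs \<noteq> ?P ys" for xs ys
    proof (rule contains_cycle_if_separated)
      show "separated ?d (ext xs) (ext ys)" using sep that by metis
    qed (use ext that d in auto)
    moreover have "?P xs \<in> hamiltonian_paths (complete_graph n)" if "xs \<in> F" for xs
      using ext that by (intro path_graph_in_hamiltonian_paths) auto
    ultimately show ?thesis unfolding cycle_union_families_def by blast
  qed
  ultimately have "card F \<le> max_cycle_union_family (?d + 1) n"
    using card_le_max_cycle_union_family by metis
  then show ?thesis using F(2) by (meson le_trans mult_le_mono1)
qed

section \<open>Upper bound by bipartitions\<close>

lemma no_odd_cycle_if_bipartite: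
  assumes "odd k" "\<And>e. e \<in> snd G \<Longrightarrow> card (e \<inter> S) = 1"
  shows "\<not> contains_cycle k G"
proof
  assume "contains_cycle k G"
  then obtain xs where xs: "distinct xs" "length xs = k" "subgraph (cycle_graph xs) G" "k \<ge> 3"
    unfolding contains_cycle_def by blast
  have step: "(xs ! (Suc i mod k) \<in> S) \<longleftrightarrow> xs ! i \<notin> S" if "i < k" for i
  proof -
    have "{xs ! i, xs ! (Suc i mod k)} \<in> snd G"
      using xs that unfolding subgraph_def cycle_graph_def by auto
    then have "card ({xs ! i, xs ! (Suc i mod k)} \<inter> S) = 1" by (rule assms(2))
    moreover have "xs ! i \<noteq> xs ! (Suc i mod k)"
      using xs that by (subst nth_eq_iff_index_eq) (auto simp: mod_Suc)
    ultimately show ?thesis by (auto simp: Int_insert_left split: if_splits)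
  qed
  have alt: "(xs ! i \<in> S) \<longleftrightarrow> (even i \<longleftrightarrow> xs ! 0 \<in> S)" if "i < k" for i
    using that
  proof (induction i)
    case (Suc i)
    then show ?case using step[of i] by auto
  qed simp
  have "even (k - 1)" "k - 1 < k" using assms(1) xs(4) by auto
  then show False using alt[of "k - 1"] step[of "k - 1"] xs(4) by simp
qed

definition even_positions :: "'a list \<Rightarrow> 'a set" where
  "even_positions xs = {xs ! i | i. i < length xs \<and> even i}"

lemma card_path_edge_even_positions:
  assumes "distinct xs" "e \<in> snd (path_graph xs)"
  shows "card (e \<inter> even_positions xs) = 1"
proof -
  obtain i where i: "e = {xs ! i, xs ! Suc i}" "Suc i < length xs"
    using assms(2) by (auto simp: path_graph_def)
  have "(xs ! k \<in> even_positions xs) \<longleftrightarrow> even k" if "k < length xs" for k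
    using that assms(1) by (auto simp: even_positions_def nth_eq_iff_index_eq)
  then show ?thesis using i by (cases "even i") (auto simp: Int_insert_left)
qed

lemma max_cycle_union_family_le:
  assumes "odd k"
  shows "max_cycle_union_family k n \<le> 2 ^ n"
proof -
  have "card F \<le> 2 ^ n" if F: "F \<in> cycle_union_families k n" for F
  proof -
    have "\<forall>P\<in>F. \<exists>xs. P = path_graph xs \<and> distinct xs \<and> set xs = {1..n}"
      using F by (auto simp: cycle_union_families_def hamiltonian_paths_def complete_graph_def)
    then obtain h where h: "\<And>P. P \<in> F \<Longrightarrow> P = path_graph (h P) \<and> distinct (h P) \<and> set (h P) = {1..n}"
      by metis
    have "inj_on (\<lambda>P. even_positions (h P)) F"
    proof (rule inj_onI, rule ccontr)
      fix P Q assume PQ: "P \<in> F" "Q \<in> F" "even_positions (h P) = even_positions (h Q)" "P \<noteq> Q"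
      have "card (e \<inter> even_positions (h P)) = 1" if "e \<in> snd (graph_union P Q)" for e
        using that card_path_edge_even_positions[of "h P" e] card_path_edge_even_positions[of "h Q" e]
          h[OF PQ(1)] h[OF PQ(2)] PQ(3) by (auto simp: graph_union_def)
      then have "\<not> contains_cycle k (graph_union P Q)"
        using no_odd_cycle_if_bipartite \<open>odd k\<close> by blast
      then show False using F PQ unfolding cycle_union_families_def by blast
    qed
    moreover have "(\<lambda>P. even_positions (h P)) ` F \<subseteq> Pow {1..n}"
    proof -
      have "even_positions (h P) \<subseteq> set (h P)" for P by (auto simp: even_positions_def)
      then show ?thesis using h by blast
    qed
    ultimately have "card F \<le> card (Pow {1..n})" by (intro card_inj_on_le) auto
    then show ?thesis by (simp add: card_Pow)
  qed
  then show ?thesis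
    unfolding max_cycle_union_family_def
    using finite_cycle_union_families cycle_union_families_nonempty by (subst Max_le_iff) auto
qed

section \<open>Asymptotics\<close>

lemma block_rate:
  fixes c \<epsilon> :: real
  assumes "\<epsilon> > 0"
  shows "\<exists>t. c * 3 ^ t \<le> \<epsilon> * 4 ^ t"
proof -
  have "(\<lambda>t. c * (3 / 4) ^ t) \<longlonglongrightarrow> c * 0"
    by (intro tendsto_intros LIMSEQ_power_zero) auto
  then have "\<forall>\<^sub>F t in sequentially. c * (3 / 4) ^ t < \<epsilon>"
    using assms by (intro order_tendstoD(2)) auto
  then obtain t where "c * (3 / 4) ^ t < \<epsilon>" by (auto simp: eventually_sequentially)
  then show ?thesis by (intro exI[of _ t]) (simp add: power_divide field_simps)
qed

theorem corollary1p6: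
  fixes l :: nat
  assumes "l \<ge> 1"
  shows "\<exists>f :: nat \<Rightarrow> real. f \<in> o(\<lambda>n. real n) \<and>
           (\<forall>n\<ge>1. real (max_cycle_union_family (2 ^ l + 1) n) = 2 powr (real n - f n))"
proof -
  define N where "N = max_cycle_union_family (2 ^ l + 1)"
  define f where "f n = real n - log 2 (N n)" for n
  have N_pos: "N n > 0" if "n \<ge> 1" for n
    using max_cycle_union_family_ge[OF assms that, of 0] by (cases "N n = 0") (auto simp: N_def)
  have f_nonneg: "f n \<ge> 0" if "n \<ge> 1" for n
  proof -
    have "N n \<le> 2 ^ n" unfolding N_def using assms by (intro max_cycle_union_family_le) auto
    then have "real (N n) \<le> 2 powr real n" by (simp add: powr_realpow)
    then show ?thesis using N_pos[OF that] by (simp add: f_def log_le_iff)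
  qed
  have f_le: "f n \<le> real n - real ((n - 1) div (4 ^ t + 2 ^ l * 3 ^ t)) * (4 ^ t - 3 ^ Suc t)"
    if "n \<ge> 1" for n t
  proof -
    define q where "q = (n - 1) div (4 ^ t + 2 ^ l * 3 ^ t)"
    have "2 ^ (q * 4 ^ t) \<le> N n * 2 ^ (q * 3 ^ Suc t)"
      unfolding N_def q_def by (rule max_cycle_union_family_ge[OF assms that])
    then have "real (2 ^ (q * 4 ^ t)) \<le> real (N n * 2 ^ (q * 3 ^ Suc t))"
      by (rule of_nat_mono)
    then have "log 2 (2 ^ (q * 4 ^ t)) \<le> log 2 (real (N n) * 2 ^ (q * 3 ^ Suc t))"
      using N_pos[OF that] by (subst log_le_cancel_iff) auto
    then have "real (q * 4 ^ t) \<le> log 2 (N n) + real (q * 3 ^ Suc t)"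
      using N_pos[OF that] by (simp add: log_mult log_nat_power del: of_nat_mult)
    then show ?thesis unfolding f_def q_def[symmetric] by (simp add: algebra_simps)
  qed
  have "f \<in> o(\<lambda>n. real n)"
  proof (rule landau_o.smallI)
    fix \<epsilon> :: real assume "\<epsilon> > 0"
    then obtain t where t: "(2 ^ l + 3) * 3 ^ t \<le> (\<epsilon> / 2) * (4::real) ^ t"
      using block_rate[of "\<epsilon> / 2"] by auto
    \<comment> \<open>With blocks of size \<open>m\<close>, each block falls short of its size by at most \<open>(2 ^ l + 3) * 3 ^ t\<close> bits;
      the left-over vertices cost at most \<open>m\<close> more.\<close>
    define m where "m = (4 ^ t + 2 ^ l * 3 ^ t :: nat)"
    have "m > 0" by (simp add: m_def)
    have "f n \<le> \<epsilon> * n" if n: "n \<ge> 1" "real n \<ge> 2 * real m / \<epsilon>" for n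
    proof -
      define q where "q = real ((n - 1) div m)"
      have "n - 1 < m * ((n - 1) div m) + m"
        using mult_div_mod_eq[of m "n - 1"] mod_less_divisor[of m "n - 1"] \<open>m > 0\<close> by linarith
      then have "n \<le> m * ((n - 1) div m) + m" by simp
      then have "real n \<le> real (m * ((n - 1) div m) + m)" by (rule of_nat_mono)
      then have q: "real n \<le> real m * q + real m" by (simp add: q_def)
      have "((n - 1) div m) * m \<le> n" by (meson div_times_less_eq_dividend diff_le_self le_trans)
      then have "real (((n - 1) div m) * m) \<le> real n" by (rule of_nat_mono)
      then have qm: "q * real m \<le> real n" by (simp add: q_def)
      have m: "real m = 4 ^ t + 2 ^ l * 3 ^ t" by (simp add: m_def)
      have "f n \<le> real n - q * (4 ^ t - 3 ^ Suc t)"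
        using f_le[OF n(1), of t] by (simp add: q_def m_def)
      also have "\<dots> \<le> real m + q * ((2 ^ l + 3) * 3 ^ t)"
        using q unfolding m by (simp add: algebra_simps)
      also have "q * ((2 ^ l + 3) * 3 ^ t) \<le> q * ((\<epsilon> / 2) * 4 ^ t)"
        using t by (intro mult_left_mono) (auto simp: q_def)
      also have "\<dots> \<le> (\<epsilon> / 2) * (q * real m)"
        using \<open>\<epsilon> > 0\<close> unfolding m by (simp add: q_def algebra_simps)
      also have "\<dots> \<le> (\<epsilon> / 2) * real n"
        using qm \<open>\<epsilon> > 0\<close> by (intro mult_left_mono) auto
      also have "real m \<le> (\<epsilon> / 2) * real n"
        using n(2) \<open>\<epsilon> > 0\<close> by (simp add: field_simps)
      finally show ?thesis by simp
    qed
    moreover have "\<forall>\<^sub>F n in sequentially. real n \<ge> 2 * real m / \<epsilon>"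
      using filterlim_real_sequentially by (simp add: filterlim_at_top)
    ultimately have "\<forall>\<^sub>F n in sequentially. n \<ge> 1 \<longrightarrow> f n \<le> \<epsilon> * real n"
      by (auto elim!: eventually_mono)
    then show "\<forall>\<^sub>F n in sequentially. norm (f n) \<le> \<epsilon> * norm (real n)"
      using eventually_ge_at_top[of "1::nat"] by eventually_elim (use f_nonneg in auto)
  qed
  moreover have "real (N n) = 2 powr (real n - f n)" if "n \<ge> 1" for n
    using N_pos[OF that] by (simp add: f_def)
  ultimately show ?thesis unfolding N_def by blast
qed

end
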